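(* Let $p>3$ be a prime for which Strong Approximation holds, i.e. the orbit of $(1,1,1)$ in $(\mathbb{Z}/p\mathbb{Z})^3$ under the Vieta group $\Gamma$ equals $\mathcal{X}^*(p)$, and let $h(p)$ be the expansion constant of the Markoff graph $\mathcal{G}_p$. For $\mathbf{x}\in\mathcal{X}^*(p)$, let $\tilde{\mathbf{x}}$ be a lift of $\mathbf{x}$ of minimal size. Then \[\operatorname{size}(\tilde{\mathbf{x}})<(3\epsilon)^{\alpha},\qquad \epsilon=\frac{3+\sqrt5}{2},\qquad \alpha=\left(\frac{p^3+3}{2}\right)^{20/\log\left(1+\frac{h(p)}{3}\right)}.\]
   Context: The Markoff surface is $X_1^2+X_2^2+X_3^2=3X_1X_2X_3$. A Markoff triple is an integer solution; $\mathcal{X}^*(p)$ is the set of solutions in $(\mathbb{Z}/p\mathbb{Z})^3$ other than $(0,0,0)$. The size of a Markoff triple is $\max\{x_1,x_2,x_3\}$; a lift of $\mathbf{x}\in\mathcal{X}^*(p)$ is a Markoff triple congruent to $\mathbf{x}$ mod $p$. The Vieta group $\Gamma$ is the group of polynomial maps of affine 3-space generated by the coordinate permutations $\sigma_{ij}$ and the Vieta involutions $R_1(x_1,x_2,x_3)=(3x_2x_3-x_1,x_2,x_3)$, $R_2(x_1,x_2,x_3)=(x_1,3x_1x_3-x_2,x_3)$, $R_3(x_1,x_2,x_3)=(x_1,x_2,3x_1x_2-x_3)$. The rotations are $\mathrm{rot}_1(x_1,x_2,x_3)=(x_1,x_3,3x_1x_3-x_2)$, $\mathrm{rot}_2(x_1,x_2,x_3)=(x_3,x_2,3x_2x_3-x_1)$,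 $\mathrm{rot}_3(x_1,x_2,x_3)=(x_2,3x_2x_3-x_1,x_3)$. The Markoff mod $p$ graph $\mathcal{G}_p$ has vertex set $\mathcal{X}^*(p)$ and edges $(\mathbf{x},\mathrm{rot}_i\mathbf{x})$ for $\mathbf{x}\in\mathcal{X}^*(p)$, $i\in\{1,2,3\}$. The expansion constant of a finite graph $G=(V,E)$ is $h(G)=\min\{|E(W)|/|W|: W\subset V,\ 1\le|W|\le|V|/2\}$, where $E(W)$ is the set of edges with exactly one endpoint in $W$. *)

theory Defs
  imports Complex_Main "HOL-Number_Theory.Cong" "HOL-Algebra.Bij" "HOL-Algebra.Generated_Groups"
begin

type_synonym triple = "int \<times> int \<times> int"

fun markoff_triple :: "triple \<Rightarrow> bool" where
  "markoff_triple (x1, x2, x3) \<longleftrightarrow> x1\<^sup>2 + x2\<^sup>2 + x3\<^sup>2 = 3 * x1 * x2 * x3"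

fun markoff_size :: "triple \<Rightarrow> int" where
  "markoff_size (x1, x2, x3) = Max {x1, x2, x3}"

text \<open>Elements of \<open>(\<int>/p\<int>)\<^sup>3\<close> are represented by their canonical representatives, i.e. the
  integer triples with all coordinates in \<open>{0..<p}\<close>. A polynomial map \<open>f\<close> with integer
  coefficients acts on them by \<open>x \<mapsto> reduce p (f x)\<close>.\<close>

fun reduce :: "nat \<Rightarrow> triple \<Rightarrow> triple" where
  "reduce p (x1, x2, x3) = (x1 mod int p, x2 mod int p, x3 mod int p)"

definition markoff_mod :: "nat \<Rightarrow> triple set" where
  "markoff_mod p =
    {(x1, x2, x3). x1 \<in> {0..<int p} \<and> x2 \<in> {0..<int p} \<and> x3 \<in> {0..<int p} \<and>
       [x1\<^sup>2 + x2\<^sup>2 + x3\<^sup>2 = 3 * x1 * x2 * x3] (mod int p)} - {(0, 0, 0)}"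

fun is_lift :: "nat \<Rightarrow> triple \<Rightarrow> triple \<Rightarrow> bool" where
  "is_lift p (x1, x2, x3) (y1, y2, y3) \<longleftrightarrow>
     markoff_triple (y1, y2, y3) \<and>
     [y1 = x1] (mod int p) \<and> [y2 = x2] (mod int p) \<and> [y3 = x3] (mod int p)"

fun perm12 :: "triple \<Rightarrow> triple" where "perm12 (x1, x2, x3) = (x2, x1, x3)"
fun perm13 :: "triple \<Rightarrow> triple" where "perm13 (x1, x2, x3) = (x3, x2, x1)"
fun perm23 :: "triple \<Rightarrow> triple" where "perm23 (x1, x2, x3) = (x1, x3, x2)"

fun vieta1 :: "triple \<Rightarrow> triple" where "vieta1 (x1, x2, x3) = (3 * x2 * x3 - x1, x2, x3)"
fun vieta2 :: "triple \<Rightarrow> triple" where "vieta2 (x1, x2, x3) = (x1, 3 * x1 * x3 - x2, x3)"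
fun vieta3 :: "triple \<Rightarrow> triple" where "vieta3 (x1, x2, x3) = (x1, x2, 3 * x1 * x2 - x3)"

text \<open>Since \<open>\<int>\<close> is infinite, a polynomial map with integer coefficients is determined by the
  function it induces on \<open>\<int>\<^sup>3\<close>, so the group of polynomial maps is realised as a group of
  bijections of \<open>\<int>\<^sup>3\<close>.\<close>

definition vieta_generators :: "(triple \<Rightarrow> triple) set" where
  "vieta_generators = {perm12, perm13, perm23, vieta1, vieta2, vieta3}"

definition vieta_group :: "(triple \<Rightarrow> triple) set" where
  "vieta_group = generate (BijGroup UNIV) vieta_generators"

lemma vieta_generators_carrier: "vieta_generators \<subseteq> carrier (BijGroup UNIV)"
proof -
  have "f \<circ> f = id" if "f \<in> vieta_generators" for f
    using that by (auto simp: vieta_generators_def fun_eq_iff)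
  then show ?thesis
    by (auto simp: BijGroup_def Bij_def extensional_def intro: o_bij)
qed

definition vieta_orbit :: "nat \<Rightarrow> triple \<Rightarrow> triple set" where
  "vieta_orbit p x = {reduce p (g x) | g. g \<in> vieta_group}"

definition strong_approximation :: "nat \<Rightarrow> bool" where
  "strong_approximation p \<longleftrightarrow> vieta_orbit p (1, 1, 1) = markoff_mod p"

fun rot1 :: "triple \<Rightarrow> triple" where "rot1 (x1, x2, x3) = (x1, x3, 3 * x1 * x3 - x2)"
fun rot2 :: "triple \<Rightarrow> triple" where "rot2 (x1, x2, x3) = (x3, x2, 3 * x2 * x3 - x1)"
fun rot3 :: "triple \<Rightarrow> triple" where "rot3 (x1, x2, x3) = (x2, 3 * x2 * x3 - x1, x3)"

definition markoff_edges :: "nat \<Rightarrow> (triple \<times> triple) set" where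
  "markoff_edges p = {(x, reduce p (r x)) | x r. x \<in> markoff_mod p \<and> r \<in> {rot1, rot2, rot3}}"

definition edge_boundary :: "('a \<times> 'a) set \<Rightarrow> 'a set \<Rightarrow> ('a \<times> 'a) set" where
  "edge_boundary E W = {(x, y) \<in> E. (x \<in> W) \<noteq> (y \<in> W)}"

text \<open>Intended for finite \<open>V\<close> with at least two elements, so that \<open>Min\<close> is taken over a finite
  nonempty set.\<close>

definition expansion_constant :: "'a set \<Rightarrow> ('a \<times> 'a) set \<Rightarrow> real" where
  "expansion_constant V E =
    Min {real (card (edge_boundary E W)) / real (card W) | W.
           W \<subseteq> V \<and> 1 \<le> card W \<and> real (card W) \<le> real (card V) / 2}"

definition markoff_expansion :: "nat \<Rightarrow> real" where
  "markoff_expansion p = expansion_constant (markoff_mod p) (markoff_edges p)"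

end

theory Submission
  imports Defs
begin

text \<open>
  The coordinate permutations fix \<open>(1,1,1)\<close> and conjugate the rotations to rotations or their
  inverses, so the \<open>\<Gamma>\<close>-orbit of \<open>(1,1,1)\<close> is already its orbit under rotations and their inverses.
  Hence strong approximation makes the Markoff graph connected and \<open>h = h(p) > 0\<close>. Every vertex
  lies on at most six edges, so a ball with at most half of the vertices grows by a factor of at
  least \<open>1 + h/6\<close> when its radius is increased by one. Two balls with more than half of the vertices
  meet, which bounds the number of steps from \<open>(1,1,1)\<close> to any vertex. Performing the same steps over
  the integers produces a lift, and one step turns a bound \<open>M\<close> on the absolute values of the
  coordinates into \<open>4M\<^sup>2\<close>, so that after \<open>L\<close> steps \<open>4M \<le> 4 ^ 2 ^ L\<close>. As
  \<open>(1 + h/6)\<^sup>2 \<ge> 1 + h/3\<close>, the exponent \<open>20\<close> leaves ample room for these losses.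
\<close>

section \<open>Distances in expanding graphs\<close>

lemma expansion_constant_le:
  assumes "finite V" "W \<subseteq> V" "1 \<le> card W" "real (card W) \<le> real (card V) / 2"
  shows "expansion_constant V E \<le> real (card (edge_boundary E W)) / real (card W)"
proof -
  let ?f = "\<lambda>W. real (card (edge_boundary E W)) / real (card W)"
  have "finite (?f ` Pow V)" using assms(1) by simp
  then have "finite {?f W | W. W \<subseteq> V \<and> 1 \<le> card W \<and> real (card W) \<le> real (card V) / 2}"
    by (rule rev_finite_subset) auto
  then show ?thesis unfolding expansion_constant_def
    using assms by (intro Min_le) auto
qed

text \<open>A minimum of finitely many positive quotients is positive. The last assumption is
  connectedness, stated through cuts.\<close>

lemma expansion_constant_pos:
  assumes "finite V" "finite E" "card V \<ge> 2"
    and "\<And>W. W \<subseteq> V \<Longrightarrow> W \<noteq> {} \<Longrightarrow> W \<noteq> V \<Longrightarrow> edge_boundary E W \<noteq> {}"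
  shows "expansion_constant V E > 0"
proof -
  let ?f = "\<lambda>W. real (card (edge_boundary E W)) / real (card W)"
  let ?S = "{?f W | W. W \<subseteq> V \<and> 1 \<le> card W \<and> real (card W) \<le> real (card V) / 2}"
  have "finite (?f ` Pow V)" using assms(1) by simp
  then have fin: "finite ?S"
    by (rule rev_finite_subset) auto
  \<comment> \<open>A singleton is admissible because \<open>card V \<ge> 2\<close>, so
    \<open>Min\<close> ranges over a nonempty set.\<close>
  obtain v where "v \<in> V" using assms(3) by fastforce
  then have "?f {v} \<in> ?S" using assms(3) by (intro CollectI exI[of _ "{v}"]) auto
  then have ne: "?S \<noteq> {}" by blast
  have "s > 0" if "s \<in> ?S" for s
  proof -
    from that obtain W where W: "s = ?f W" "W \<subseteq> V" "1 \<le> card W" "real (card W) \<le> real (card V) / 2"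
      by blast
    have "W \<noteq> {}" "W \<noteq> V" using W(3,4) assms(3) by auto
    then have "edge_boundary E W \<noteq> {}" using assms(4) W(2) by blast
    moreover have "finite (edge_boundary E W)"
      using assms(2) by (rule rev_finite_subset) (auto simp: edge_boundary_def)
    ultimately have "card (edge_boundary E W) > 0" by (simp add: card_gt_0_iff)
    then show ?thesis using W(1,3) by simp
  qed
  then show ?thesis unfolding expansion_constant_def
    using fin ne by (subst Min_gr_iff) auto
qed

text \<open>Edges are ordered pairs, so incoming and outgoing ones both count, as in
  \<open>edge_boundary\<close>; a loop counts once.\<close>

definition incident_edges :: "('a \<times> 'a) set \<Rightarrow> 'a \<Rightarrow> ('a \<times> 'a) set" where
  "incident_edges E v = {e \<in> E. fst e = v \<or> snd e = v}"

lemma expansion_constant_le_degree: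
  assumes "finite V" "finite E" "card V \<ge> 2" "v \<in> V" "card (incident_edges E v) \<le> d"
  shows "expansion_constant V E \<le> real d"
proof -
  have "finite (incident_edges E v)" using assms(2) by (simp add: incident_edges_def)
  then have "card (edge_boundary E {v}) \<le> card (incident_edges E v)"
    by (rule card_mono) (auto simp: edge_boundary_def incident_edges_def)
  with assms(5) have "card (edge_boundary E {v}) \<le> d" by simp
  moreover have "expansion_constant V E \<le> real (card (edge_boundary E {v})) / real (card {v})"
    using assms by (intro expansion_constant_le) auto
  ultimately show ?thesis by simp
qed

section \<open>Ball growth and diameter\<close>

text \<open>Each boundary edge of \<open>B\<close> has an endpoint among the new vertices of the
  neighbourhood, and a new vertex absorbs at most \<open>d\<close> such edges. Hence at least
  \<open>card B\<close> times the expansion constant over \<open>d\<close> vertices are new.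
  \<open>Id\<close> keeps \<open>B\<close> inside its neighbourhood.\<close>

lemma expander_neighbourhood_growth:
  assumes "finite V" "E \<subseteq> V \<times> V" "d > 0"
    and deg: "\<And>v. v \<in> V \<Longrightarrow> card (incident_edges E v) \<le> d"
    and B: "B \<subseteq> V" "B \<noteq> {}" "real (card B) \<le> real (card V) / 2"
  shows "(1 + expansion_constant V E / d) * card B \<le> card ((E \<union> E\<inverse> \<union> Id) `` B)"
proof -
  let ?h = "expansion_constant V E"
  let ?C = "(E \<union> E\<inverse> \<union> Id) `` B"
  have CV: "?C \<subseteq> V" using assms(2) B(1) by auto
  have finC: "finite ?C" "finite B" using CV B(1) assms(1) finite_subset by blast+
  have finE: "finite E" using assms(1,2) by (meson finite_SigmaI finite_subset)
  have cB: "card B \<ge> 1" using B(2) finC by (simp add: Suc_le_eq card_gt_0_iff)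
  have "edge_boundary E B \<subseteq> (\<Union>v\<in>?C - B. incident_edges E v)"
  proof
    fix e assume e: "e \<in> edge_boundary E B"
    obtain a b where ab: "e = (a, b)" by fastforce
    have "(a \<in> ?C - B) \<or> (b \<in> ?C - B)" using e ab by (auto simp: edge_boundary_def)
    then show "e \<in> (\<Union>v\<in>?C - B. incident_edges E v)"
      using e ab by (auto simp: edge_boundary_def incident_edges_def)
  qed
  then have "card (edge_boundary E B) \<le> card (\<Union>v\<in>?C - B. incident_edges E v)"
    using finC finE by (intro card_mono) (auto simp: incident_edges_def)
  also have "\<dots> \<le> (\<Sum>v\<in>?C - B. card (incident_edges E v))"
    using finC by (intro card_UN_le) auto
  also have "\<dots> \<le> (\<Sum>v\<in>?C - B. d)" using deg CV by (intro sum_mono) auto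
  finally have 1: "real (card (edge_boundary E B)) \<le> real (card (?C - B)) * real d"
    by (metis of_nat_mult of_nat_mono sum_constant of_nat_id)
  have "?h \<le> real (card (edge_boundary E B)) / real (card B)"
    using assms(1) B cB by (intro expansion_constant_le) auto
  then have "?h * card B \<le> real (card (edge_boundary E B))"
    using cB by (simp add: field_simps)
  with 1 have "?h * card B / d \<le> card (?C - B)" using assms(3) by (simp add: field_simps)
  moreover have "card ?C = card (?C - B) + card B"
  proof -
    have "B \<subseteq> ?C" by auto
    then show ?thesis using finC by (metis card_Diff_subset card_mono le_add_diff_inverse2)
  qed
  ultimately show ?thesis by (simp add: algebra_simps)
qed

text \<open>Balls are nested, so if the one of radius \<open>n\<close> held at most half of
  \<open>V\<close>, all smaller ones would too, and the growth factor would apply \<open>n\<close>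
  times, starting from one vertex.\<close>

lemma expander_ball_large:
  assumes "finite V" "E \<subseteq> V \<times> V" "d > 0"
    and deg: "\<And>v. v \<in> V \<Longrightarrow> card (incident_edges E v) \<le> d"
    and "x \<in> V" "expansion_constant V E > 0"
    and n: "(1 + expansion_constant V E / d) ^ n > real (card V) / 2"
  shows "real (card (((E \<union> E\<inverse> \<union> Id) ^^ n) `` {x})) > real (card V) / 2"
proof (rule ccontr)
  let ?T = "E \<union> E\<inverse> \<union> Id" and ?q = "1 + expansion_constant V E / d"
  let ?B = "\<lambda>k. (?T ^^ k) `` {x}"
  assume small: "\<not> ?thesis"
  have BV: "?B k \<subseteq> V" for k
  proof (induction k)
    case (Suc k)
    have "?B (Suc k) = ?T `` ?B k" by auto
    then show ?case using Suc assms(2) by auto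
  qed (use assms in auto)
  have finB: "finite (?B k)" for k using BV assms(1) finite_subset by blast
  have step: "?B (Suc k) = ?T `` ?B k" for k by auto
  have mono: "?B k \<subseteq> ?B (Suc k)" for k unfolding step by auto
  have le_n: "card (?B k) \<le> card (?B n)" if "k \<le> n" for k
    using finB lift_Suc_mono_le[of ?B, OF mono that] by (intro card_mono) auto
  have ne: "?B k \<noteq> {}" for k
    by (induction k) (simp, use mono in blast)
  have "?q ^ k \<le> real (card (?B k))" if "k \<le> n" for k
    using that
  proof (induction k)
    case (Suc k)
    have "?q ^ Suc k \<le> ?q * card (?B k)"
      using Suc assms(3,6) by (simp add: mult_left_mono)
    also have "\<dots> \<le> card (?T `` ?B k)"
      using small le_n[of k] Suc.prems
      by (intro expander_neighbourhood_growth assms BV ne) auto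
    finally show ?case unfolding step .
  qed auto
  from this[of n] n small show False by simp
qed

lemma expander_diameter:
  assumes "finite V" "E \<subseteq> V \<times> V" "d > 0"
    and "\<And>v. v \<in> V \<Longrightarrow> card (incident_edges E v) \<le> d"
    and "x \<in> V" "y \<in> V" "expansion_constant V E > 0"
    and "(1 + expansion_constant V E / d) ^ n > real (card V) / 2"
  shows "(x, y) \<in> (E \<union> E\<inverse> \<union> Id) ^^ (2 * n)"
proof -
  let ?T = "E \<union> E\<inverse> \<union> Id"
  let ?B = "\<lambda>x. (?T ^^ n) `` {x}"
  have BV: "(?T ^^ k) `` {x} \<subseteq> V" if "x \<in> V" for x k
  proof (induction k)
    case (Suc k)
    have "(?T ^^ Suc k) `` {x} = ?T `` ((?T ^^ k) `` {x})" by auto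
    then show ?case using Suc assms(2) by auto
  qed (use that in auto)
  have "?B x \<inter> ?B y \<noteq> {}"
  proof
    assume "?B x \<inter> ?B y = {}"
    then have "card (?B x) + card (?B y) = card (?B x \<union> ?B y)"
      using BV assms(1,5,6) by (metis card_Un_disjoint finite_subset)
    also have "\<dots> \<le> card V" using BV assms by (intro card_mono) auto
    finally have "real (card (?B x)) + real (card (?B y)) \<le> card V" by linarith
    moreover have "real (card (?B x)) > card V / 2" "real (card (?B y)) > card V / 2"
      using expander_ball_large[OF assms(1-4) _ assms(7,8)] assms(5,6) by blast+
    ultimately show False by simp
  qed
  then obtain z where z: "(x, z) \<in> ?T ^^ n" "(y, z) \<in> ?T ^^ n" by auto
  \<comment> \<open>The converse edges make the relation symmetric, so the walk from
    \<open>y\<close> to the common vertex \<open>z\<close> can be reversed.\<close>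
  have "sym ?T" by (auto simp: sym_def)
  then have "sym (?T ^^ n)"
  proof (induction n)
    case (Suc n)
    then show ?case unfolding sym_def by (meson relpow_Suc_E relpow_Suc_I2)
  qed (simp add: sym_Id)
  then have "(z, y) \<in> ?T ^^ n" using z(2) by (rule symD)
  with z(1) show ?thesis by (auto simp: mult_2 relpow_add)
qed

section \<open>Rotations of Markoff triples\<close>

fun rot1_inv :: "triple \<Rightarrow> triple" where "rot1_inv (x1, x2, x3) = (x1, 3 * x1 * x2 - x3, x2)"
fun rot2_inv :: "triple \<Rightarrow> triple" where "rot2_inv (x1, x2, x3) = (3 * x1 * x2 - x3, x2, x1)"
fun rot3_inv :: "triple \<Rightarrow> triple" where "rot3_inv (x1, x2, x3) = (3 * x1 * x3 - x2, x1, x3)"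

text \<open>Pairing each rotation with its inverse lets one statement cover all three rotations and
  both directions of a step.\<close>

definition rotations :: "((triple \<Rightarrow> triple) \<times> (triple \<Rightarrow> triple)) set" where
  "rotations = {(rot1, rot1_inv), (rot2, rot2_inv), (rot3, rot3_inv)}"

lemma rotation_inverse:
  assumes "(r, s) \<in> rotations"
  shows "s (r x) = x" "r (s x) = x"
  using assms unfolding rotations_def by (cases x; elim insertE emptyE; simp)+

text \<open>The difference of the two sides of the Markoff equation. Its invariance serves both the
  integer equation and the congruence modulo \<open>p\<close>.\<close>

fun markoff_form :: "triple \<Rightarrow> int" where
  "markoff_form (x1, x2, x3) = x1\<^sup>2 + x2\<^sup>2 + x3\<^sup>2 - 3 * x1 * x2 * x3"

text \<open>For fixed \<open>a\<close>, \<open>b\<close> the form depends on \<open>c\<close> only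
  through \<open>c * (c - 3 * a * b)\<close>, which is unchanged under
  \<open>c \<mapsto> 3 * a * b - c\<close>; a rotation is such a move up to a permutation.\<close>

lemma markoff_form_rotation:
  assumes "(r, s) \<in> rotations"
  shows "markoff_form (r x) = markoff_form x" "markoff_form (s x) = markoff_form x"
proof -
  have form_r: "markoff_form (r x) = markoff_form x" for x
    using assms unfolding rotations_def
    by (cases x) (auto simp: power2_eq_square algebra_simps)
  then show "markoff_form (r x) = markoff_form x" .
  show "markoff_form (s x) = markoff_form x"
    using form_r[of "s x"] by (simp add: rotation_inverse[OF assms])
qed

lemma markoff_triple_rotation:
  assumes "(r, s) \<in> rotations" "markoff_triple x"
  shows "markoff_triple (r x)" "markoff_triple (s x)"
proof -
  have "markoff_triple y \<longleftrightarrow> markoff_form y = 0" for y by (cases y) simp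
  then show "markoff_triple (r x)" "markoff_triple (s x)"
    using assms by (simp_all add: markoff_form_rotation[OF assms(1)])
qed

text \<open>Polynomial maps over the integers respect congruences. This links steps of an integer
  walk to edges modulo \<open>p\<close>.\<close>

lemma reduce_rotation:
  assumes "(r, s) \<in> rotations"
  shows "reduce p (r (reduce p x)) = reduce p (r x)" "reduce p (s (reduce p x)) = reduce p (s x)"
proof -
  have vieta: "(3 * (a mod int p) * (b mod int p) - c mod int p) mod int p = (3 * a * b - c) mod int p"
    for a b c
    unfolding cong_def[symmetric] by (intro cong_diff cong_mult cong_refl) (simp_all add: cong_def)
  show "reduce p (r (reduce p x)) = reduce p (r x)" "reduce p (s (reduce p x)) = reduce p (s x)"
    using assms unfolding rotations_def by (cases x; elim insertE emptyE; simp add: vieta)+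
qed

section \<open>Growth of coordinates under a rotation\<close>

fun coords_bounded :: "int \<Rightarrow> triple \<Rightarrow> bool" where
  "coords_bounded M (x1, x2, x3) \<longleftrightarrow> \<bar>x1\<bar> \<le> M \<and> \<bar>x2\<bar> \<le> M \<and> \<bar>x3\<bar> \<le> M"

lemma vieta_coordinate_bound:
  fixes a b c M :: int
  assumes "\<bar>a\<bar> \<le> M" "\<bar>b\<bar> \<le> M" "\<bar>c\<bar> \<le> M"
  shows "\<bar>c\<bar> \<le> 4 * M\<^sup>2" "\<bar>3 * a * b - c\<bar> \<le> 4 * M\<^sup>2"
proof -
  \<comment> \<open>Integrality matters here: the inequality fails for reals strictly between 0 and
    1.\<close>
  have M: "M \<le> M\<^sup>2"
  proof (cases "M \<le> 0")
    case False
    then show ?thesis by (simp add: power2_eq_square)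
  qed (use zero_le_power2[of M] in linarith)
  have "\<bar>a * b\<bar> \<le> M * M" unfolding abs_mult using assms by (intro mult_mono) auto
  then have "\<bar>a * b\<bar> \<le> M\<^sup>2" by (simp add: power2_eq_square)
  moreover have "3 * a * b = 3 * (a * b)" by simp
  ultimately show "\<bar>3 * a * b - c\<bar> \<le> 4 * M\<^sup>2" using M assms(3) by linarith
  show "\<bar>c\<bar> \<le> 4 * M\<^sup>2" using M assms(3) zero_le_power2[of M] by linarith
qed

lemma coords_bounded_rotation:
  assumes "(r, s) \<in> rotations" "coords_bounded M x"
  shows "coords_bounded (4 * M\<^sup>2) (r x)" "coords_bounded (4 * M\<^sup>2) (s x)"
proof -
  obtain a b c where x: "x = (a, b, c)" by (cases x) auto
  then have "\<bar>a\<bar> \<le> M" "\<bar>b\<bar> \<le> M" "\<bar>c\<bar> \<le> M" using assms(2) by simp_all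
  note bounds = this vieta_coordinate_bound[OF this(1,2,3)] vieta_coordinate_bound[OF this(1,3,2)]
    vieta_coordinate_bound[OF this(2,3,1)]
  show "coords_bounded (4 * M\<^sup>2) (r x)" "coords_bounded (4 * M\<^sup>2) (s x)"
    using assms(1) bounds unfolding rotations_def x by (elim insertE emptyE; simp)+
qed

section \<open>The orbit of (1,1,1) under rotations contains its \<Gamma>-orbit\<close>

inductive_set rotation_orbit :: "triple set" where
  base: "(1, 1, 1) \<in> rotation_orbit"
| rot: "x \<in> rotation_orbit \<Longrightarrow> (r, s) \<in> rotations \<Longrightarrow> r x \<in> rotation_orbit"
| rot_inv: "x \<in> rotation_orbit \<Longrightarrow> (r, s) \<in> rotations \<Longrightarrow> s x \<in> rotation_orbit"

lemma rotation_orbit_closed: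
  assumes "x \<in> rotation_orbit"
  shows "rot1 x \<in> rotation_orbit" "rot2 x \<in> rotation_orbit" "rot3 x \<in> rotation_orbit"
    "rot1_inv x \<in> rotation_orbit" "rot2_inv x \<in> rotation_orbit" "rot3_inv x \<in> rotation_orbit"
  using rotation_orbit.rot[OF assms, of rot1 rot1_inv] rotation_orbit.rot[OF assms, of rot2 rot2_inv]
    rotation_orbit.rot[OF assms, of rot3 rot3_inv] rotation_orbit.rot_inv[OF assms, of rot1 rot1_inv]
    rotation_orbit.rot_inv[OF assms, of rot2 rot2_inv] rotation_orbit.rot_inv[OF assms, of rot3 rot3_inv]
  by (simp_all add: rotations_def)

lemma permutation_conjugates_rotation:
  "perm12 (rot1 x) = rot2 (perm12 x)" "perm12 (rot1_inv x) = rot2_inv (perm12 x)"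
  "perm12 (rot2 x) = rot1 (perm12 x)" "perm12 (rot2_inv x) = rot1_inv (perm12 x)"
  "perm12 (rot3 x) = rot3_inv (perm12 x)" "perm12 (rot3_inv x) = rot3 (perm12 x)"
  "perm13 (rot1 x) = rot3_inv (perm13 x)" "perm13 (rot1_inv x) = rot3 (perm13 x)"
  "perm13 (rot2 x) = rot2_inv (perm13 x)" "perm13 (rot2_inv x) = rot2 (perm13 x)"
  "perm13 (rot3 x) = rot1_inv (perm13 x)" "perm13 (rot3_inv x) = rot1 (perm13 x)"
  "perm23 (rot1 x) = rot1_inv (perm23 x)" "perm23 (rot1_inv x) = rot1 (perm23 x)"
  "perm23 (rot2 x) = rot3 (perm23 x)" "perm23 (rot2_inv x) = rot3_inv (perm23 x)"
  "perm23 (rot3 x) = rot2 (perm23 x)" "perm23 (rot3_inv x) = rot2_inv (perm23 x)"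
  by (cases x; simp)+

lemma permutation_rotation_orbit:
  assumes "x \<in> rotation_orbit"
  shows "perm12 x \<in> rotation_orbit" "perm13 x \<in> rotation_orbit" "perm23 x \<in> rotation_orbit"
proof -
  have "perm12 x \<in> rotation_orbit \<and> perm13 x \<in> rotation_orbit \<and> perm23 x \<in> rotation_orbit"
    using assms
  proof induction
    case base
    then show ?case by (simp add: rotation_orbit.base)
  next
    case (rot x r s)
    then show ?case unfolding rotations_def
      by (auto simp: permutation_conjugates_rotation rotation_orbit_closed)
  next
    case (rot_inv x r s)
    then show ?case unfolding rotations_def
      by (auto simp: permutation_conjugates_rotation rotation_orbit_closed)
  qed
  then show "perm12 x \<in> rotation_orbit" "perm13 x \<in> rotation_orbit" "perm23 x \<in> rotation_orbit"
    by blast+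
qed

text \<open>Each Vieta involution is a rotation or an inverse rotation followed by a transposition,
  and the orbit is closed under both.\<close>

lemma generator_rotation_orbit:
  assumes "f \<in> vieta_generators" "x \<in> rotation_orbit"
  shows "f x \<in> rotation_orbit"
proof -
  have "vieta1 x = perm13 (rot2 x)" "vieta2 x = perm23 (rot1 x)" "vieta3 x = perm23 (rot1_inv x)"
    by (cases x; simp)+
  then show ?thesis
    using assms unfolding vieta_generators_def
    by (elim insertE emptyE) (simp_all add: permutation_rotation_orbit rotation_orbit_closed)
qed

lemma vieta_group_rotation_orbit:
  assumes "g \<in> vieta_group" "x \<in> rotation_orbit"
  shows "g x \<in> rotation_orbit"
proof -
  interpret group "BijGroup (UNIV :: triple set)" by (rule group_BijGroup)
  have "g \<in> generate (BijGroup UNIV) vieta_generators" using assms(1) by (simp add: vieta_group_def)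
  then show ?thesis using assms(2)
  proof (induction arbitrary: x)
    case one
    then show ?case by (simp add: BijGroup_def)
  next
    case (incl h)
    then show ?case by (simp add: generator_rotation_orbit)
  next
    case (inv h)
    have "h \<in> carrier (BijGroup UNIV)" using inv(1) vieta_generators_carrier by blast
    \<comment> \<open>All generators are involutions, so group inverses of generators add nothing
      new.\<close>
    moreover have "h (h y) = y" for y
      using inv(1) by (cases y) (auto simp: vieta_generators_def)
    ultimately have "inv\<^bsub>BijGroup UNIV\<^esub> h = h"
      by (intro inv_equality) (auto simp: BijGroup_def compose_def fun_eq_iff)
    then show ?case using inv by (simp add: generator_rotation_orbit)
  next
    case (eng h1 h2)
    have "h1 \<in> Bij UNIV" "h2 \<in> Bij UNIV"
      using eng.hyps[THEN generate_in_carrier[OF vieta_generators_carrier]]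
      by (simp_all add: BijGroup_def)
    then show ?case using eng.IH eng.prems by (simp add: BijGroup_def compose_def)
  qed
qed

section \<open>The Markoff graph modulo \<open>p\<close>\<close>

lemma finite_markoff_mod: "finite (markoff_mod p)"
  and card_markoff_mod_le: "card (markoff_mod p) \<le> p ^ 3"
proof -
  let ?I = "{0..<int p}"
  have sub: "markoff_mod p \<subseteq> ?I \<times> ?I \<times> ?I" by (auto simp: markoff_mod_def)
  moreover have "finite (?I \<times> ?I \<times> ?I)" by simp
  ultimately show "finite (markoff_mod p)" by (rule finite_subset)
  have "card (markoff_mod p) \<le> card (?I \<times> ?I \<times> ?I)" using sub by (intro card_mono) auto
  then show "card (markoff_mod p) \<le> p ^ 3" by (simp add: card_cartesian_product power3_eq_cube)
qed

lemma card_markoff_mod_ge: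
  assumes "p > 2"
  shows "card (markoff_mod p) \<ge> 2"
proof -
  \<comment> \<open>Two integer Markoff triples; \<open>p > 2\<close> makes them canonical
    representatives.\<close>
  have "{(1, 1, 1), (1, 1, 2)} \<subseteq> markoff_mod p" using assms by (auto simp: markoff_mod_def)
  from card_mono[OF finite_markoff_mod this] show ?thesis by simp
qed

lemma reduce_markoff_mod: "x \<in> markoff_mod p \<Longrightarrow> reduce p x = x"
  by (cases x) (auto simp: markoff_mod_def)

lemma rotation_markoff_mod:
  assumes "(r, s) \<in> rotations" "x \<in> markoff_mod p"
  shows "reduce p (r x) \<in> markoff_mod p"
proof -
  obtain a b c where x: "x = (a, b, c)" by (cases x) auto
  have p: "int p > 0" using assms(2) by (auto simp: markoff_mod_def)
  obtain u v w where uvw: "r x = (u, v, w)" by (cases "r x") auto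
  then have eq: "u\<^sup>2 + v\<^sup>2 + w\<^sup>2 - 3 * u * v * w = a\<^sup>2 + b\<^sup>2 + c\<^sup>2 - 3 * a * b * c"
    using markoff_form_rotation(1)[OF assms(1), of x] by (simp add: x)
  have "int p dvd a\<^sup>2 + b\<^sup>2 + c\<^sup>2 - 3 * a * b * c"
    using assms(2) by (auto simp: x markoff_mod_def cong_iff_dvd_diff)
  then have uvw_cong: "[u\<^sup>2 + v\<^sup>2 + w\<^sup>2 = 3 * u * v * w] (mod int p)"
    by (simp add: cong_iff_dvd_diff eq)
  have mod_cong: "[n mod int p = n] (mod int p)" for n by (simp add: cong_def)
  have "[(u mod p)\<^sup>2 + (v mod p)\<^sup>2 + (w mod p)\<^sup>2 = u\<^sup>2 + v\<^sup>2 + w\<^sup>2] (mod int p)"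
    by (intro cong_add cong_pow mod_cong)
  also note uvw_cong
  also have "[3 * u * v * w = 3 * (u mod p) * (v mod p) * (w mod p)] (mod int p)"
    by (intro cong_mult cong_refl mod_cong[THEN cong_sym])
  finally have "[(u mod p)\<^sup>2 + (v mod p)\<^sup>2 + (w mod p)\<^sup>2 = 3 * (u mod p) * (v mod p) * (w mod p)] (mod int p)" .
  \<comment> \<open>The inverse rotation fixes the zero triple, so a nonzero \<open>x\<close> cannot
    be sent to zero.\<close>
  moreover have "reduce p (r x) \<noteq> (0, 0, 0)"
  proof
    assume 0: "reduce p (r x) = (0, 0, 0)"
    have "x = reduce p (s (reduce p (r x)))"
      using assms by (simp add: reduce_rotation rotation_inverse reduce_markoff_mod)
    also have "\<dots> = (0, 0, 0)" using assms(1) by (auto simp: 0 rotations_def)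
    finally show False using assms(2) by (simp add: markoff_mod_def)
  qed
  ultimately show ?thesis using p by (simp add: markoff_mod_def uvw)
qed

lemma markoff_edges_eq:
  "markoff_edges p = {(x, reduce p (r x)) | x r s. x \<in> markoff_mod p \<and> (r, s) \<in> rotations}"
  unfolding markoff_edges_def rotations_def by blast

lemma markoff_edgeI:
  assumes "x \<in> markoff_mod p" "(r, s) \<in> rotations"
  shows "(x, reduce p (r x)) \<in> markoff_edges p"
  unfolding markoff_edges_eq using assms by blast

lemma markoff_edges_subset: "markoff_edges p \<subseteq> markoff_mod p \<times> markoff_mod p"
  by (auto simp: markoff_edges_eq rotation_markoff_mod)

lemma finite_markoff_edges: "finite (markoff_edges p)"
  using markoff_edges_subset finite_markoff_mod by (meson finite_SigmaI finite_subset)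

lemma markoff_edge_source:
  assumes "x \<in> markoff_mod p" "(r, s) \<in> rotations"
  shows "reduce p (s (reduce p (r x))) = x"
  using assms by (simp add: reduce_rotation rotation_inverse reduce_markoff_mod)

text \<open>Each rotation gives one outgoing edge and at most one incoming edge, whose source is
  recovered by the inverse rotation.\<close>

lemma card_incident_markoff_edges: "card (incident_edges (markoff_edges p) v) \<le> 6"
proof -
  let ?f = "\<lambda>(r, s). (v, reduce p (r v))" and ?g = "\<lambda>(r, s). (reduce p (s v), v)"
  have fin: "finite rotations" by (simp add: rotations_def)
  have c: "card rotations \<le> 3" by (simp add: rotations_def card_insert_if)
  have "incident_edges (markoff_edges p) v \<subseteq> ?f ` rotations \<union> ?g ` rotations"
    by (force simp: incident_edges_def markoff_edges_eq markoff_edge_source)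
  then have "card (incident_edges (markoff_edges p) v) \<le> card (?f ` rotations \<union> ?g ` rotations)"
    using fin by (intro card_mono) auto
  also have "\<dots> \<le> card (?f ` rotations) + card (?g ` rotations)" by (rule card_Un_le)
  also have "\<dots> \<le> card rotations + card rotations" using fin by (intro add_mono card_image_le)
  finally show ?thesis using c by simp
qed

section \<open>Connectedness and bounds for h(p)\<close>

text \<open>With no edge leaving or entering, \<open>U\<close> absorbs the reduction of the whole
  rotation orbit of (1,1,1), hence its \<Gamma>-orbit, which strong approximation says is
  everything.\<close>

lemma rotation_closed_eq_markoff_mod:
  assumes "strong_approximation p" "p > 1" "U \<subseteq> markoff_mod p" "(1, 1, 1) \<in> U"
    and "edge_boundary (markoff_edges p) U = {}"
  shows "U = markoff_mod p"
proof -
  have closed: "a \<in> U \<longleftrightarrow> b \<in> U" if "(a, b) \<in> markoff_edges p" for a b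
    using assms(5) that unfolding edge_boundary_def by blast
  have "reduce p z \<in> U" if "z \<in> rotation_orbit" for z
    using that
  proof induction
    case base
    then show ?case using assms by simp
  next
    case (rot z r s)
    then have "(reduce p z, reduce p (r (reduce p z))) \<in> markoff_edges p"
      using assms(3) by (intro markoff_edgeI) auto
    then show ?case using closed rot by (metis reduce_rotation(1))
  next
    case (rot_inv z r s)
    define V where "V = markoff_mod p"
    define f where "f = (\<lambda>v. reduce p (r v))"
    \<comment> \<open>An inverse step is a forward edge read backwards. The rotation is injective on
      a finite set, hence onto, so the current vertex has a predecessor, and it equals
      \<open>reduce p (s z)\<close>.\<close>
    have "inj_on f V"
      by (rule inj_on_inverseI[where g = "\<lambda>v. reduce p (s v)"])
        (use rot_inv in \<open>simp add: f_def V_def markoff_edge_source\<close>)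
    moreover have "f ` V \<subseteq> V" using rot_inv by (auto simp: f_def V_def rotation_markoff_mod)
    ultimately have "f ` V = V" by (intro endo_inj_surj) (auto simp: V_def finite_markoff_mod)
    moreover have "reduce p z \<in> V" using rot_inv assms(3) by (auto simp: V_def)
    ultimately obtain v where v: "v \<in> V" "reduce p z = f v" by blast
    have "reduce p (s z) = reduce p (s (f v))"
      using rot_inv v by (metis reduce_rotation(2))
    also have "\<dots> = v" using v rot_inv by (simp add: f_def V_def markoff_edge_source)
    finally have "reduce p (s z) = v" .
    moreover have "(v, f v) \<in> markoff_edges p"
      using v rot_inv unfolding V_def f_def by (intro markoff_edgeI) auto
    ultimately show ?case using closed v rot_inv by metis
  qed
  then have "vieta_orbit p (1, 1, 1) \<subseteq> U"
    using vieta_group_rotation_orbit[OF _ rotation_orbit.base] unfolding vieta_orbit_def by blast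
  then show ?thesis using assms by (auto simp: strong_approximation_def)
qed

lemma markoff_expansion_pos:
  assumes "strong_approximation p" "p > 2"
  shows "markoff_expansion p > 0"
  unfolding markoff_expansion_def
proof (rule expansion_constant_pos[OF finite_markoff_mod finite_markoff_edges])
  show "card (markoff_mod p) \<ge> 2" using assms by (intro card_markoff_mod_ge)
  fix W assume W: "W \<subseteq> markoff_mod p" "W \<noteq> {}" "W \<noteq> markoff_mod p"
  show "edge_boundary (markoff_edges p) W \<noteq> {}"
  proof
    assume 0: "edge_boundary (markoff_edges p) W = {}"
    \<comment> \<open>A set and its complement have the same boundary, so whichever of them contains
      (1,1,1) must be everything.\<close>
    then have 1: "edge_boundary (markoff_edges p) (markoff_mod p - W) = {}"
      using markoff_edges_subset[of p] by (auto simp: edge_boundary_def)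
    have "(1, 1, 1) \<in> markoff_mod p" using assms by (auto simp: markoff_mod_def)
    then consider "(1, 1, 1) \<in> W" | "(1, 1, 1) \<in> markoff_mod p - W" by blast
    then show False
    proof cases
      case 1
      then show ?thesis using rotation_closed_eq_markoff_mod[of p W] 0 W assms by auto
    next
      case 2
      then have "markoff_mod p - W = markoff_mod p"
        using 1 assms by (intro rotation_closed_eq_markoff_mod) auto
      then show ?thesis using W by blast
    qed
  qed
qed

lemma markoff_expansion_le:
  assumes "p > 2"
  shows "markoff_expansion p \<le> 6"
proof -
  have "(1, 1, 1) \<in> markoff_mod p" using assms by (auto simp: markoff_mod_def)
  then show ?thesis unfolding markoff_expansion_def
    using expansion_constant_le_degree[OF finite_markoff_mod finite_markoff_edges
        card_markoff_mod_ge _ card_incident_markoff_edges] assms by fastforce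
qed

section \<open>Lifting walks to the integers\<close>

lemma lift_of_walk:
  assumes "((1, 1, 1), x) \<in> (markoff_edges p \<union> (markoff_edges p)\<inverse> \<union> Id) ^^ k" "p > 1"
  shows "\<exists>z M. markoff_triple z \<and> reduce p z = x \<and> coords_bounded M z \<and> 4 * M = 4 ^ 2 ^ k"
  using assms(1)
proof (induction k arbitrary: x)
  case 0
  then show ?case using assms(2) by (intro exI[of _ "(1, 1, 1)"] exI[of _ 1]) auto
next
  case (Suc k)
  let ?E = "markoff_edges p"
  from Suc.prems obtain y where y: "((1, 1, 1), y) \<in> (?E \<union> ?E\<inverse> \<union> Id) ^^ k"
    "(y, x) \<in> ?E \<union> ?E\<inverse> \<union> Id" by (rule relpow_Suc_E)
  from Suc.IH[OF y(1)] obtain z M where z: "markoff_triple z" "reduce p z = y"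
    "coords_bounded M z" "4 * M = 4 ^ 2 ^ k" by blast
  \<comment> \<open>The normalisation by 4 turns the step from \<open>M\<close> to
    \<open>4 * M\<^sup>2\<close> into plain squaring, so the exponent of 4 doubles.\<close>
  have "4 * (4 * M\<^sup>2) = (4 * M)\<^sup>2" by (simp add: power2_eq_square)
  also have "\<dots> = 4 ^ 2 ^ Suc k" unfolding z(4) by (simp add: power_mult[symmetric] mult.commute)
  finally have M: "4 * (4 * M\<^sup>2) = 4 ^ 2 ^ Suc k" .
  consider (fwd) r s where "(r, s) \<in> rotations" "x = reduce p (r y)"
    | (bwd) r s where "(r, s) \<in> rotations" "x \<in> markoff_mod p" "y = reduce p (r x)"
    | (same) "x = y"
    using y(2) unfolding markoff_edges_eq by blast
  then have "\<exists>z'. markoff_triple z' \<and> reduce p z' = x \<and> coords_bounded (4 * M\<^sup>2) z'"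
  proof cases
    case fwd
    then show ?thesis using z
      by (intro exI[of _ "r z"])
        (auto simp: markoff_triple_rotation coords_bounded_rotation reduce_rotation)
  next
    case bwd
    \<comment> \<open>An edge traversed backwards is lifted by the integer inverse rotation.\<close>
    have "reduce p (s z) = reduce p (s y)" using bwd(1) z(2) reduce_rotation(2) by metis
    then have "reduce p (s z) = x" using bwd by (simp add: markoff_edge_source)
    then show ?thesis using z bwd
      by (intro exI[of _ "s z"]) (auto simp: markoff_triple_rotation coords_bounded_rotation)
  next
    case same
    have "coords_bounded (4 * M\<^sup>2) z"
      using z(3) by (cases z) (auto intro: vieta_coordinate_bound)
    then show ?thesis using z same by blast
  qed
  then show ?case using M by blast
qed

lemma is_lift_reduce:
  assumes "markoff_triple z"
  shows "is_lift p (reduce p z) z"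
  using assms by (cases z) (auto simp: cong_def)

section \<open>Existence of minimal lifts\<close>

text \<open>Three negative coordinates would make the right side of the equation negative and the
  left side a sum of squares. Size is a maximum without absolute values, so this lower bound is what
  allows a least size.\<close>

lemma markoff_size_nonneg:
  assumes "markoff_triple x"
  shows "markoff_size x \<ge> 0"
proof (rule ccontr)
  obtain a b c where x: "x = (a, b, c)" by (cases x) auto
  assume "\<not> ?thesis"
  then have neg: "a < 0" "b < 0" "c < 0" by (auto simp: x)
  then have "a * b * c < 0" by (simp add: mult_neg_neg mult_pos_neg)
  moreover have "a\<^sup>2 + b\<^sup>2 + c\<^sup>2 \<ge> 0" by simp
  moreover have "a\<^sup>2 + b\<^sup>2 + c\<^sup>2 = 3 * (a * b * c)" using assms by (simp add: x)
  ultimately show False by linarith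
qed

lemma minimal_lift_exists:
  assumes "is_lift p x z"
  shows "\<exists>y. is_arg_min markoff_size (is_lift p x) y"
proof -
  have nonneg: "markoff_size y \<ge> 0" if "is_lift p x y" for y
    using that by (intro markoff_size_nonneg) (cases x; cases y; simp)
  obtain y where y: "is_lift p x y"
    "\<And>y'. is_lift p x y' \<Longrightarrow> nat (markoff_size y) \<le> nat (markoff_size y')"
    using ex_has_least_nat[of "is_lift p x" z "\<lambda>y. nat (markoff_size y)"] assms by blast
  then show ?thesis
    using nonneg unfolding is_arg_min_def by (meson nat_less_eq_zless not_less)
qed

section \<open>Radius versus exponent\<close>

text \<open>Rounding \<open>ln A / q\<close> up gives \<open>n \<le> ln A / q + 1\<close>. Both
  \<open>ln A / q \<le> 2 * (ln A / l)\<close> and \<open>1 \<le> ln A / l\<close> hold, so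
  \<open>2 * n\<close> is at most 6, hence at most 20, times \<open>ln A / l\<close>; finally 2 is
  replaced by exp 1.\<close>

lemma two_power_le_powr:
  fixes A h :: real
  assumes "0 < h" "h \<le> 6" "3 \<le> A"
  obtains n where "A \<le> (1 + h / 6) ^ n" "2 ^ (2 * n) \<le> A powr (20 / ln (1 + h / 3))"
proof -
  define l q n where "l = ln (1 + h / 3)" and "q = ln (1 + h / 6)" and "n = nat \<lceil>ln A / q\<rceil>"
  have l: "l > 0" and q: "q > 0" using assms by (auto simp: l_def q_def)
  have "l \<le> ln ((1 + h / 6)\<^sup>2)"
    unfolding l_def using assms by (intro ln_mono) (auto simp: power2_eq_square algebra_simps)
  also have "\<dots> = 2 * q" using assms unfolding q_def by (subst ln_realpow) auto
  finally have lq: "l \<le> 2 * q" .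
  \<comment> \<open>From \<open>h \<le> 6\<close> follows \<open>1 + h / 3 \<le> 3 \<le> A\<close>;
    this absorbs the rounding error in \<open>n\<close>.\<close>
  have lA: "l \<le> ln A" unfolding l_def using assms by (subst ln_le_cancel_iff) auto
  have A: "ln A \<ge> 0" using lA l by simp
  have n1: "ln A / q \<le> n" unfolding n_def by linarith
  have "ln A / q \<ge> 0" using A q by simp
  then have n2: "n \<le> ln A / q + 1" unfolding n_def by linarith
  have "ln A \<le> n * q" using n1 q by (simp add: field_simps)
  also have "\<dots> = ln ((1 + h / 6) ^ n)" unfolding q_def using assms by (subst ln_realpow) auto
  finally have 1: "A \<le> (1 + h / 6) ^ n" using assms by (subst (asm) ln_le_cancel_iff) auto
  have "ln A / q \<le> 2 * (ln A / l)"
    using mult_right_mono[OF lq A] l q by (simp add: field_simps)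
  moreover have "1 \<le> ln A / l" using lA l by (simp add: field_simps)
  ultimately have "real (2 * n) \<le> 20 * (ln A / l)" using n2 by linarith
  then have "exp (real (2 * n)) \<le> A powr (20 / l)" using assms by (simp add: powr_def)
  moreover have "(2::real) ^ (2 * n) \<le> exp 1 ^ (2 * n)"
    using exp_ge_add_one_self[of 1] by (intro power_mono) auto
  moreover have "exp 1 ^ (2 * n) = exp (real (2 * n))" by (simp add: exp_of_nat_mult[symmetric])
  ultimately have "2 ^ (2 * n) \<le> A powr (20 / l)" by linarith
  with 1 that show thesis by (simp add: l_def)
qed

theorem theorem1p3:
  fixes p :: nat and x :: triple and \<epsilon> \<alpha> :: real
  assumes "prime p" and "p > 3"
    and "strong_approximation p"
    and "x \<in> markoff_mod p"
    and "\<epsilon> = (3 + sqrt 5) / 2"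
    and "\<alpha> = ((real p ^ 3 + 3) / 2) powr (20 / ln (1 + markoff_expansion p / 3))"
  shows "(\<exists>y. is_arg_min markoff_size (is_lift p x) y) \<and>
         (\<forall>y. is_arg_min markoff_size (is_lift p x) y \<longrightarrow>
              real_of_int (markoff_size y) < (3 * \<epsilon>) powr \<alpha>)"
proof -
  define A where "A = (real p ^ 3 + 3) / 2"
  define h where "h = markoff_expansion p"
  have h: "0 < h" "h \<le> 6"
    using markoff_expansion_pos markoff_expansion_le assms by (auto simp: h_def)
  have "real p ^ 3 \<ge> 3 ^ 3" using assms(2) by (intro power_mono) auto
  then have "A \<ge> 3" by (simp add: A_def)
  from two_power_le_powr[OF h this] obtain n where n: "A \<le> (1 + h / 6) ^ n" "2 ^ (2 * n) \<le> \<alpha>"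
    unfolding assms(6) A_def h_def by metis
  have "real (card (markoff_mod p)) \<le> real p ^ 3"
    using card_markoff_mod_le[of p] by (metis of_nat_le_iff of_nat_power)
  then have "real (card (markoff_mod p)) < real p ^ 3 + 3" by (rule le_less_trans) simp
  then have "real (card (markoff_mod p)) / 2 < A"
    unfolding A_def by (rule divide_strict_right_mono) simp
  then have big: "(1 + h / 6) ^ n > real (card (markoff_mod p)) / 2" using n(1) by simp
  have "(1, 1, 1) \<in> markoff_mod p" using assms by (auto simp: markoff_mod_def)
  then have "((1, 1, 1), x) \<in> (markoff_edges p \<union> (markoff_edges p)\<inverse> \<union> Id) ^^ (2 * n)"
    using big h assms(4) card_incident_markoff_edges
    by (intro expander_diameter[OF finite_markoff_mod markoff_edges_subset, where d = 6])
      (auto simp: h_def markoff_expansion_def)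
  from lift_of_walk[OF this] assms(2) obtain z M where z: "markoff_triple z" "reduce p z = x"
    "coords_bounded M z" "4 * M = 4 ^ 2 ^ (2 * n)" by auto
  have lift: "is_lift p x z" using is_lift_reduce z by blast
  have "markoff_size z \<le> M" using z(3) by (cases z) auto
  \<comment> \<open>Positivity of \<open>M\<close> makes the final inequality strict.\<close>
  moreover have "M < 4 * M" using z(4) zero_less_power[of "4::int" "2 ^ (2 * n)"] by linarith
  ultimately have "real_of_int (markoff_size z) < real_of_int (4 * M)" by linarith
  also have "\<dots> = 4 powr (2 ^ (2 * n))"
    unfolding z(4) by (simp add: powr_realpow[symmetric])
  also have "\<dots> \<le> 4 powr \<alpha>" using n(2) by (intro powr_mono) auto
  also have "\<dots> \<le> (3 * \<epsilon>) powr \<alpha>"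
  proof (rule powr_mono2)
    show "0 \<le> \<alpha>" by (simp add: assms(6))
    \<comment> \<open>Already \<open>sqrt 5 \<ge> 0\<close> gives
      \<open>3 * \<epsilon> \<ge> 9 / 2\<close>, above the base 4 of the walk bound.\<close>
    have "sqrt 5 \<ge> 0" by simp
    then show "4 \<le> 3 * \<epsilon>" by (simp add: assms(5))
  qed simp
  finally have bound: "real_of_int (markoff_size z) < (3 * \<epsilon>) powr \<alpha>" .
  have "markoff_size y \<le> markoff_size z" if "is_arg_min markoff_size (is_lift p x) y" for y
    using that lift unfolding is_arg_min_def by (meson not_less)
  with bound have "real_of_int (markoff_size y) < (3 * \<epsilon>) powr \<alpha>"
    if "is_arg_min markoff_size (is_lift p x) y" for y
    using that by (meson le_less_trans of_int_le_iff)
  then show ?thesis using minimal_lift_exists[OF lift] by blast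
qed

end
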